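(* Let $0 \le \alpha < 1$ and let $f = h + \overline{g} \in \mathcal{F}(\alpha)$. For each $\lambda \in \mathbb{C}$ with $|\lambda| = 1$ put $F_\lambda(z) := h(z) + \lambda g(z)$, $z \in \mathbb{D}$. Then for every $r \in (0,1)$, every $\lambda$ with $|\lambda|=1$, and all $t, \psi \in \mathbb{R}$ with $re^{it} \neq re^{i\psi}$, $$\left|\frac{F_\lambda(re^{it}) - F_\lambda(re^{i\psi})}{re^{it} - re^{i\psi}}\right| \ \ge\ A(r,\alpha) \quad\text{and}\quad \left|\frac{f(re^{it}) - f(re^{i\psi})}{re^{it} - re^{i\psi}}\right| \ \ge\ A(r,\alpha),$$ where $A(r,\alpha) := \dfrac{1-r^2}{r^2}\, L(r,\alpha)^2$ and $$L(r,\alpha) := \begin{cases} \dfrac{2r}{1+r} - \log(1+r), & \alpha = 0,\\[2mm] 2\log(1+r) - r, & \alpha = 1/2,\\[2mm] \dfrac{(1+r)^{2\alpha}(1+r+2\alpha - 2r\alpha) - (1+r)(1+2\alpha)}{2\alpha(1+r)(2\alpha-1)}, & \alpha \in (0,1)\setminus\{1/2\}.\end{cases}$$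
   Context: $\mathbb{D} = \{z \in \mathbb{C} : |z| < 1\}$. For $\alpha \ge -1/2$, $\mathcal{F}(\alpha)$ denotes the set of complex-valued harmonic functions $f = h + \overline{g}$ on $\mathbb{D}$, with $h, g$ analytic in $\mathbb{D}$ normalized by $h(0) = g(0) = 0$, $h'(0) = 1$, such that $\operatorname{Re}\left(1 + \frac{z h''(z)}{h'(z)}\right) > \alpha$ for all $z \in \mathbb{D}$ and, for some real constant $\theta$, $g'(z) = e^{i\theta} z h'(z)$ for all $z \in \mathbb{D}$. (Equivalently, $L(r,\alpha) = \int_0^r (1-\rho)(1+\rho)^{-2(1-\alpha)}\,d\rho$.) *)

theory Defs
  imports "HOL-Analysis.Analysis"
begin

text \<open>The class F(alpha): harmonic f = h + conj g on the unit disc.\<close>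
definition classF :: "real \<Rightarrow> (complex \<Rightarrow> complex) \<Rightarrow> (complex \<Rightarrow> complex) \<Rightarrow> bool" where
  "classF \<alpha> h g \<longleftrightarrow>
     h holomorphic_on ball 0 1 \<and> g holomorphic_on ball 0 1 \<and>
     h 0 = 0 \<and> g 0 = 0 \<and> deriv h 0 = 1 \<and>
     (\<forall>z\<in>ball 0 1. deriv h z \<noteq> 0 \<and>
        Re (1 + z * deriv (deriv h) z / deriv h z) > \<alpha>) \<and>
     (\<exists>\<theta>::real. \<forall>z\<in>ball 0 1. deriv g z = exp (\<i> * of_real \<theta>) * z * deriv h z)"

definition Lfun :: "real \<Rightarrow> real \<Rightarrow> real" where
  "Lfun r \<alpha> =
    (if \<alpha> = 0 then 2 * r / (1 + r) - ln (1 + r)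
     else if \<alpha> = 1/2 then 2 * ln (1 + r) - r
     else ((1 + r) powr (2 * \<alpha>) * (1 + r + 2 * \<alpha> - 2 * r * \<alpha>) - (1 + r) * (1 + 2 * \<alpha>))
          / (2 * \<alpha> * (1 + r) * (2 * \<alpha> - 1)))"

definition Afun :: "real \<Rightarrow> real \<Rightarrow> real" where
  "Afun r \<alpha> = (1 - r^2) / r^2 * (Lfun r \<alpha>)^2"

end

theory Submission
  imports Defs "HOL-Complex_Analysis.Complex_Analysis"
begin

text \<open>
  Write \<open>F = h + \<lambda> g\<close>, so that \<open>F' = h' \<phi>\<close> with \<open>\<phi> x = 1 + \<mu> x\<close> and \<open>|\<mu>| = 1\<close>. Since \<open>\<alpha> \<ge> 0\<close>, the
  function \<open>h\<close> is convex. Hence, for \<open>|z| = |w| = r\<close>, the quotient \<open>(F z - F w) / (h z - h w)\<close>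
  lies in the closed convex hull of the values of \<open>\<phi>\<close> on the circle of radius \<open>r\<close>, and in
  particular its real part is at least \<open>1 - r\<close>. The same principle applied to the identity in
  place of \<open>F\<close>, where \<open>\<phi> = 1 / h'\<close>, bounds \<open>|h z - h w| / |z - w|\<close> from below by the minimum of
  \<open>|h'|\<close> on the circle, which is at least \<open>(1 + r) powr (2 \<alpha> - 2)\<close> by Schwarz's lemma. The product
  \<open>(1 - r) (1 + r) powr (2 \<alpha> - 2)\<close> of the two bounds is at least \<open>A(r, \<alpha>)\<close>, because
  \<open>L(r, \<alpha>) \<le> r (1 + r) powr (\<alpha> - 3/2)\<close>, as one sees by comparing derivatives in \<open>r\<close>.
\<close>

section \<open>Derivatives along circles and rays\<close>

lemma Re_of_real_mult: "Re (of_real x * y) = x * Re y"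
  by simp

lemma has_real_derivative_Re_along:
  assumes "(f has_field_derivative D) (at (c t))" "(c has_vector_derivative c') (at t)"
  shows "((\<lambda>t. Re (f (c t))) has_real_derivative Re (D * c')) (at t)"
proof -
  have "((f \<circ> c) has_vector_derivative c' * D) (at t)"
    by (rule field_vector_diff_chain_at) (use assms in auto)
  from bounded_linear.has_vector_derivative[OF bounded_linear_Re this]
  show ?thesis
    by (simp add: has_real_derivative_iff_has_vector_derivative o_def mult.commute)
qed

lemma has_real_derivative_Im_along:
  assumes "(f has_field_derivative D) (at (c t))" "(c has_vector_derivative c') (at t)"
  shows "((\<lambda>t. Im (f (c t))) has_real_derivative Im (D * c')) (at t)"
proof -
  have "((f \<circ> c) has_vector_derivative c' * D) (at t)"
    by (rule field_vector_diff_chain_at) (use assms in auto)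
  from bounded_linear.has_vector_derivative[OF bounded_linear_Im this]
  show ?thesis
    by (simp add: has_real_derivative_iff_has_vector_derivative o_def mult.commute)
qed

lemma has_vector_derivative_circle:
  "((\<lambda>t. w * exp (\<i> * of_real t)) has_vector_derivative \<i> * (w * exp (\<i> * of_real t))) (at t)"
  by (auto intro!: derivative_eq_intros has_vector_derivative_real_field)

lemma has_vector_derivative_ray:
  "((\<lambda>t. of_real t * w) has_vector_derivative w) (at t)" for w :: complex
  by (auto intro!: derivative_eq_intros has_vector_derivative_real_field)

section \<open>The integral behind \<open>Lfun\<close> and the estimate of
  \<open>Afun\<close>\<close>

lemma Lfun_0: "Lfun 0 \<alpha> = 0"
  by (simp add: Lfun_def)

text \<open>This identifies \<open>Lfun\<close> as the integral of the stated derivative from 0; the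
  three branches are its antiderivatives. Together with \<open>Lfun_0\<close> it replaces the case
  formula from here on.\<close>

lemma has_real_derivative_Lfun:
  assumes "0 \<le> \<rho>"
  shows "((\<lambda>\<rho>. Lfun \<rho> \<alpha>) has_real_derivative (1 - \<rho>) * (1 + \<rho>) powr (2 * \<alpha> - 2)) (at \<rho>)"
proof -
  consider "\<alpha> = 0" | "\<alpha> = 1/2" | "\<alpha> \<noteq> 0" "\<alpha> \<noteq> 1/2" by blast
  then show ?thesis
  proof cases
    case 1
    have e: "(1 + \<rho>) powr (-2) = 1 / (1 + \<rho>)^2"
      using assms by (simp add: powr_minus powr_numeral divide_simps)
    have "((\<lambda>\<rho>. 2 * \<rho> / (1 + \<rho>) - ln (1 + \<rho>)) has_real_derivative (1 - \<rho>) / (1 + \<rho>)^2) (at \<rho>)"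
      using assms
      by (auto intro!: derivative_eq_intros simp: add_nonneg_eq_0_iff)
        (simp add: divide_simps power2_eq_square, simp add: algebra_simps)
    then show ?thesis using 1 e by (simp add: Lfun_def)
  next
    case 2
    have e: "(1 + \<rho>) powr (-1) = 1 / (1 + \<rho>)"
      using assms by (simp add: powr_minus divide_simps)
    have "((\<lambda>\<rho>. 2 * ln (1 + \<rho>) - \<rho>) has_real_derivative (1 - \<rho>) / (1 + \<rho>)) (at \<rho>)"
      using assms by (auto intro!: derivative_eq_intros simp: divide_simps)
    then show ?thesis unfolding 2 using e by (simp add: Lfun_def)
  next
    case 3
    define d where "d = 2 * \<alpha> * (2 * \<alpha> - 1)"
    have d: "d \<noteq> 0" using 3 by (auto simp: d_def)
    \<comment> \<open>\<open>G\<close> is the third branch with the common factor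
      \<open>1 + x\<close> cancelled, which leaves a single power to differentiate.\<close>
    define G where "G x = ((1 + x) powr (2 * \<alpha> - 1) * (1 + x + 2 * \<alpha> - 2 * x * \<alpha>) - (1 + 2 * \<alpha>)) / d" for x
    have G: "Lfun x \<alpha> = G x" if "x > -1" for x
    proof -
      have "(1 + x) powr (2 * \<alpha>) = (1 + x) powr (2 * \<alpha> - 1) * (1 + x)"
        using that powr_add[of "1 + x" "2 * \<alpha> - 1" 1] by simp
      then have "Lfun x \<alpha> = ((1 + x) * ((1 + x) powr (2 * \<alpha> - 1) * (1 + x + 2 * \<alpha> - 2 * x * \<alpha>) - (1 + 2 * \<alpha>))) / ((1 + x) * d)"
        using 3 by (simp add: Lfun_def d_def algebra_simps)
      then show ?thesis using that by (simp add: G_def)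
    qed
    have e: "(1 + \<rho>) powr (2 * \<alpha> - 1) = (1 + \<rho>) powr (2 * \<alpha> - 2) * (1 + \<rho>)"
      using assms powr_add[of "1 + \<rho>" "2 * \<alpha> - 2" 1] by simp
    have "(G has_real_derivative 
        ((2 * \<alpha> - 1) * (1 + \<rho>) powr (2 * \<alpha> - 2) * (1 + \<rho> + 2 * \<alpha> - 2 * \<rho> * \<alpha>)
          + (1 + \<rho>) powr (2 * \<alpha> - 1) * (1 - 2 * \<alpha>)) / d) (at \<rho>)"
      unfolding G_def using assms d by (auto intro!: derivative_eq_intros) 
    also have "((2 * \<alpha> - 1) * (1 + \<rho>) powr (2 * \<alpha> - 2) * (1 + \<rho> + 2 * \<alpha> - 2 * \<rho> * \<alpha>)
          + (1 + \<rho>) powr (2 * \<alpha> - 1) * (1 - 2 * \<alpha>)) = d * ((1 - \<rho>) * (1 + \<rho>) powr (2 * \<alpha> - 2))"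
      unfolding e d_def by (simp add: algebra_simps)
    finally have "(G has_real_derivative (1 - \<rho>) * (1 + \<rho>) powr (2 * \<alpha> - 2)) (at \<rho>)"
      using d by simp
    then show ?thesis
      by (rule has_field_derivative_transform_within_open[where S = "{-1<..}"])
         (use assms G in auto)
  qed
qed

text \<open>Bernoulli's inequality for exponents in [0,1]: the slope
  \<open>s * (1 + y) powr (s - 1)\<close> of the left side never exceeds \<open>s\<close>.\<close>

lemma powr_le_one_plus_mult:
  fixes s x :: real
  assumes "0 \<le> s" "s \<le> 1" "0 \<le> x"
  shows "(1 + x) powr s \<le> 1 + s * x"
proof -
  let ?H = "\<lambda>x. 1 + s * x - (1 + x) powr s"
  have "?H 0 \<le> ?H x"
  proof (rule DERIV_nonneg_imp_nondecreasing[OF assms(3)])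
    fix y :: real assume y: "0 \<le> y" "y \<le> x"
    have "(?H has_real_derivative s * (1 - (1 + y) powr (s - 1))) (at y)"
      using y by (auto intro!: derivative_eq_intros simp: algebra_simps)
    moreover have "(1 + y) powr (s - 1) \<le> (1 + y) powr 0"
      using y assms by (intro powr_mono) auto
    then have "0 \<le> s * (1 - (1 + y) powr (s - 1))" using assms y by simp
    ultimately show "\<exists>d. (?H has_real_derivative d) (at y) \<and> 0 \<le> d" by blast
  qed
  then show ?thesis by simp
qed

text \<open>This is the derivative comparison needed in \<open>Lfun_le\<close>, after cancelling
  \<open>(1 + \<rho>) powr (\<alpha> - 5/2)\<close>. Bernoulli's inequality wants an exponent in
  [0,1]: for \<open>\<alpha> \<le> 1/2\<close> it applies to the whole power, otherwise to the power
  left after splitting off one factor \<open>1 + \<rho>\<close>, which is absorbed by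
  \<open>(1 - \<rho>) * (1 + \<rho>) \<le> 1\<close>.\<close>

lemma Lfun_integrand_bound:
  fixes \<alpha> \<rho> :: real
  assumes "0 \<le> \<alpha>" "\<alpha> < 1" "0 \<le> \<rho>" "\<rho> \<le> 1"
  shows "(1 - \<rho>) * (1 + \<rho>) powr (\<alpha> + 1/2) \<le> 1 + (\<alpha> - 1/2) * \<rho>"
proof (cases "\<alpha> \<le> 1/2")
  case True
  have "(1 - \<rho>) * (1 + \<rho>) powr (\<alpha> + 1/2) \<le> (1 - \<rho>) * (1 + (\<alpha> + 1/2) * \<rho>)"
    using assms True by (intro mult_left_mono powr_le_one_plus_mult) auto
  also have "\<dots> = 1 + (\<alpha> - 1/2) * \<rho> - (\<alpha> + 1/2) * \<rho>\<^sup>2"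
    by (simp add: field_simps power2_eq_square)
  also have "\<dots> \<le> 1 + (\<alpha> - 1/2) * \<rho>" using assms by simp
  finally show ?thesis .
next
  case False
  have "(1 + \<rho>) powr (\<alpha> + 1/2) = (1 + \<rho>) powr (\<alpha> - 1/2) * (1 + \<rho>)"
    using assms powr_add[of "1 + \<rho>" "\<alpha> - 1/2" 1] by (simp add: add.commute)
  also have "\<dots> \<le> (1 + (\<alpha> - 1/2) * \<rho>) * (1 + \<rho>)"
    using assms False by (intro mult_right_mono powr_le_one_plus_mult) auto
  finally have "(1 - \<rho>) * (1 + \<rho>) powr (\<alpha> + 1/2) \<le> (1 - \<rho>) * ((1 + (\<alpha> - 1/2) * \<rho>) * (1 + \<rho>))"
    using assms by (intro mult_left_mono) auto
  also have "\<dots> = (1 + (\<alpha> - 1/2) * \<rho>) * (1 - \<rho>\<^sup>2)"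
    by (simp add: algebra_simps power2_eq_square)
  also have "\<dots> \<le> (1 + (\<alpha> - 1/2) * \<rho>) * 1"
    using assms False by (intro mult_left_mono) auto
  finally show ?thesis by simp
qed

lemma Lfun_nonneg:
  assumes "0 \<le> r" "r \<le> 1"
  shows "0 \<le> Lfun r \<alpha>"
proof -
  have "Lfun 0 \<alpha> \<le> Lfun r \<alpha>"
  proof (rule DERIV_nonneg_imp_nondecreasing[OF assms(1)])
    fix x assume "0 \<le> x" "x \<le> r"
    then show "\<exists>y. ((\<lambda>r. Lfun r \<alpha>) has_real_derivative y) (at x) \<and> 0 \<le> y"
      using assms has_real_derivative_Lfun[of x \<alpha>]
      by (intro exI[of _ "(1 - x) * (1 + x) powr (2 * \<alpha> - 2)"]) auto
  qed
  then show ?thesis by (simp add: Lfun_0)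
qed

text \<open>The exponent is chosen so that squaring this bound and multiplying by
  \<open>(1 - r^2) / r^2\<close> gives exactly
  \<open>(1 - r) * (1 + r) powr (2 * \<alpha> - 2)\<close>. Both sides vanish at 0, so comparing
  derivatives suffices.\<close>

lemma Lfun_le:
  assumes "0 \<le> \<alpha>" "\<alpha> < 1" "0 \<le> r" "r \<le> 1"
  shows "Lfun r \<alpha> \<le> r * (1 + r) powr (\<alpha> - 3/2)"
proof -
  let ?H = "\<lambda>x. x * (1 + x) powr (\<alpha> - 3/2) - Lfun x \<alpha>"
  have "?H 0 \<le> ?H r"
  proof (rule DERIV_nonneg_imp_nondecreasing[OF assms(3)])
    fix x assume x: "0 \<le> x" "x \<le> r"
    let ?p = "(1 + x) powr (\<alpha> - 5/2)"
    have p1: "(1 + x) powr (\<alpha> - 3/2) = ?p * (1 + x)"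
      using x powr_add[of "1 + x" "\<alpha> - 5/2" 1] by simp
    have p2: "(1 + x) powr (2 * \<alpha> - 2) = ?p * (1 + x) powr (\<alpha> + 1/2)"
      by (simp flip: powr_add)
    have "((\<lambda>x. x * (1 + x) powr (\<alpha> - 3/2)) has_real_derivative
        (1 + x) powr (\<alpha> - 3/2) + x * ((\<alpha> - 3/2) * ?p)) (at x)"
      using x by (auto intro!: derivative_eq_intros)
    then have "((\<lambda>x. x * (1 + x) powr (\<alpha> - 3/2)) has_real_derivative ?p * (1 + (\<alpha> - 1/2) * x)) (at x)"
      unfolding p1 by (simp add: algebra_simps)
    from DERIV_diff[OF this has_real_derivative_Lfun[of x \<alpha>]]
    have "(?H has_real_derivative ?p * (1 + (\<alpha> - 1/2) * x - (1 - x) * (1 + x) powr (\<alpha> + 1/2))) (at x)"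
      using x unfolding p2 by (simp add: algebra_simps)
    moreover have "0 \<le> ?p * (1 + (\<alpha> - 1/2) * x - (1 - x) * (1 + x) powr (\<alpha> + 1/2))"
      using Lfun_integrand_bound[of \<alpha> x] assms x by (intro mult_nonneg_nonneg) auto
    ultimately show "\<exists>y. (?H has_real_derivative y) (at x) \<and> 0 \<le> y" by blast
  qed
  then show ?thesis by (simp add: Lfun_0)
qed

lemma Afun_le:
  assumes "0 \<le> \<alpha>" "\<alpha> < 1" "0 < r" "r < 1"
  shows "Afun r \<alpha> \<le> (1 - r) * (1 + r) powr (2 * \<alpha> - 2)"
proof -
  have "(Lfun r \<alpha>)\<^sup>2 \<le> (r * (1 + r) powr (\<alpha> - 3/2))\<^sup>2"
    using Lfun_nonneg[of r \<alpha>] Lfun_le[of \<alpha> r] assms by (intro power_mono) auto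
  also have "\<dots> = r\<^sup>2 * (1 + r) powr (2 * \<alpha> - 3)"
    by (simp add: power_mult_distrib power2_eq_square flip: powr_add)
  finally have "Afun r \<alpha> \<le> (1 - r\<^sup>2) / r\<^sup>2 * (r\<^sup>2 * (1 + r) powr (2 * \<alpha> - 3))"
    unfolding Afun_def using assms by (intro mult_left_mono) (auto simp: power_le_one)
  also have "\<dots> = (1 - r) * ((1 + r) powr (2 * \<alpha> - 3) * (1 + r))"
    using assms by (simp add: power2_eq_square field_simps)
  also have "(1 + r) powr (2 * \<alpha> - 3) * (1 + r) = (1 + r) powr (2 * \<alpha> - 2)"
    using assms powr_add[of "1 + r" "2 * \<alpha> - 3" 1] by simp
  finally show ?thesis .
qed

section \<open>Convex mappings: support lines and separation of points\<close>

text \<open>The analytic form of convexity. The geometric facts required, support lines and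
  separation of points, are derived from it below.\<close>

locale convex_mapping =
  fixes h :: "complex \<Rightarrow> complex"
  assumes holomorphic: "h holomorphic_on ball 0 1"
    and deriv_nonzero: "\<And>z. z \<in> ball 0 1 \<Longrightarrow> deriv h z \<noteq> 0"
    and convex_condition: "\<And>z. z \<in> ball 0 1 \<Longrightarrow> Re (1 + z * deriv (deriv h) z / deriv h z) > 0"
begin

lemma has_deriv: "z \<in> ball 0 1 \<Longrightarrow> (h has_field_derivative deriv h z) (at z)"
  using holomorphic by (intro holomorphic_derivI) auto

text \<open>A branch of log h' makes the argument of h' a single-valued smooth function on the disc;
  its derivative is the quotient occurring in the convexity condition.\<close>

lemma log_deriv_exists:
  obtains k where "\<And>z. z \<in> ball 0 1 \<Longrightarrow> exp (k z) = deriv h z"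
    "\<And>z. z \<in> ball 0 1 \<Longrightarrow> (k has_field_derivative deriv (deriv h) z / deriv h z) (at z)"
proof -
  have hol': "deriv h holomorphic_on ball 0 1"
    using holomorphic by (intro holomorphic_deriv) auto
  obtain k where k: "k holomorphic_on ball 0 1" "\<And>z. z \<in> ball 0 1 \<Longrightarrow> exp (k z) = deriv h z"
    using holomorphic_logarithm_exists[of "ball 0 1" "deriv h" 0] hol' deriv_nonzero by auto
  have "(k has_field_derivative deriv (deriv h) z / deriv h z) (at z)" if z: "z \<in> ball 0 1" for z
  proof -
    have k': "(k has_field_derivative deriv k z) (at z)"
      using k(1) z by (intro holomorphic_derivI) auto
    then have "((\<lambda>z. exp (k z)) has_field_derivative exp (k z) * deriv k z) (at z)"
      by (auto intro!: derivative_eq_intros)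
    then have "(deriv h has_field_derivative exp (k z) * deriv k z) (at z)"
      by (rule has_field_derivative_transform_within_open[where S = "ball 0 1"]) (use z k in auto)
    then have "deriv (deriv h) z = deriv h z * deriv k z"
      using DERIV_imp_deriv k(2) z by fastforce
    then show ?thesis using k' deriv_nonzero[OF z] by simp
  qed
  with k(2) show ?thesis using that by blast
qed

text \<open>The tangent angle \<open>t + Im (log (h' (w exp (\<i> t))))\<close> of the image of a circle increases
  by exactly \<open>2\<pi>\<close> over one turn, so the distance to the tangent line at \<open>h w\<close> first increases
  and then decreases along the curve.\<close>
lemma support_line_circle:
  assumes "cmod w < 1" "cmod z = cmod w" "z \<noteq> w"
  shows "Re (cnj (w * deriv h w) * (h z - h w)) < 0"
proof -
  have w0: "w \<noteq> 0" using assms by auto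
  obtain k where k: "\<And>z. z \<in> ball 0 1 \<Longrightarrow> exp (k z) = deriv h z"
    "\<And>z. z \<in> ball 0 1 \<Longrightarrow> (k has_field_derivative deriv (deriv h) z / deriv h z) (at z)"
    using log_deriv_exists by blast
  define c where "c t = w * exp (\<i> * of_real t)" for t :: real
  have c_ball: "c t \<in> ball 0 1" for t
    using assms by (simp add: c_def norm_mult)
  have c': "(c has_vector_derivative \<i> * c t) (at t)" for t
    unfolding c_def by (rule has_vector_derivative_circle)
  define a where "a t = t + Im (k (c t))" for t
  have a': "(a has_real_derivative Re (1 + c t * deriv (deriv h) (c t) / deriv h (c t))) (at t)" for t
  proof -
    have "(a has_real_derivative 1 + Im (deriv (deriv h) (c t) / deriv h (c t) * (\<i> * c t))) (at t)"
      unfolding a_def by (intro derivative_intros has_real_derivative_Im_along k c_ball c')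
    moreover have "deriv (deriv h) (c t) / deriv h (c t) * (\<i> * c t) = \<i> * (c t * deriv (deriv h) (c t) / deriv h (c t))"
      by simp
    ultimately show ?thesis by (simp only: Im_i_times plus_complex.sel one_complex.sel)
  qed
  have a_mono: "a s < a t" if "s < t" for s t
    using that
  proof (rule DERIV_pos_imp_increasing)
    fix x
    show "\<exists>y. (a has_real_derivative y) (at x) \<and> 0 < y"
      using a' convex_condition[OF c_ball] by blast
  qed
  have c0: "c 0 = w" "c (2 * pi) = w"
    by (simp_all add: c_def mult.commute)
  \<comment> \<open>\<open>k\<close> is single valued, so only the summand \<open>t\<close> changes
    over a full turn.\<close>
  have a2pi: "a (2 * pi) = a 0 + 2 * pi"
    by (simp add: a_def c0)
  \<comment> \<open>\<open>u\<close> measures h along the outer normal direction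
    \<open>w * deriv h w\<close> at \<open>h w\<close>. Its derivative is the real part of a number
    with modulus \<open>m t\<close> and argument \<open>pi/2 + a t - a 0\<close>.\<close>
  define u where "u t = Re (cnj (w * deriv h w) * h (c t))" for t
  define m where "m t = (cmod w)\<^sup>2 * exp (Re (k w) + Re (k (c t)))" for t
  have m: "m t > 0" for t using w0 by (simp add: m_def)
  have u': "(u has_real_derivative - m t * sin (a t - a 0)) (at t)" for t
  proof -
    have "((\<lambda>z. cnj (w * deriv h w) * h z) has_field_derivative cnj (w * deriv h w) * deriv h (c t)) (at (c t))"
      by (intro derivative_intros DERIV_cmult has_deriv c_ball)
    then have "(u has_real_derivative Re (cnj (w * deriv h w) * deriv h (c t) * (\<i> * c t))) (at t)"
      unfolding u_def by (rule has_real_derivative_Re_along[OF _ c'])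
    moreover have "cnj (w * deriv h w) * deriv h (c t) * (\<i> * c t)
        = of_real ((cmod w)\<^sup>2) * (\<i> * exp (cnj (k w) + k (c t) + \<i> * of_real t))"
    proof -
      have "deriv h w = exp (k w)" "deriv h (c t) = exp (k (c t))"
        using k(1)[OF c_ball] k(1)[of w] assms by auto
      then show ?thesis
        unfolding complex_norm_square by (simp add: exp_add c_def exp_cnj)
    qed
    moreover have "Re (\<i> * exp (cnj (k w) + k (c t) + \<i> * of_real t)) = - exp (Re (k w) + Re (k (c t))) * sin (a t - a 0)"
      by (simp add: Im_exp a_def c0 algebra_simps)
    ultimately have "(u has_real_derivative (cmod w)\<^sup>2 * (- exp (Re (k w) + Re (k (c t))) * sin (a t - a 0))) (at t)"
      by (simp only: Re_of_real_mult)
    then show ?thesis by (simp add: m_def mult_ac)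
  qed
  have u_cont: "continuous_on A u" for A
    using u' by (meson DERIV_isCont continuous_at_imp_continuous_on)
  define \<tau> where "\<tau> = Arg2pi (z / w)"
  have z: "z = c \<tau>"
    using complex_norm_eq_1_exp[of "z / w"] assms w0 by (simp add: c_def \<tau>_def norm_divide)
  have \<tau>: "0 < \<tau>" "\<tau> < 2 * pi"
    using Arg2pi_lt_2pi[of "z / w"] Arg2pi_ge_0[of "z / w"] assms z c0 
    unfolding \<tau>_def[symmetric] by (auto simp: less_le)
  have "u \<tau> < u 0"
  \<comment> \<open>Both 0 and \<open>2 * pi\<close> parametrise \<open>w\<close>, so the comparison
    starts from whichever end keeps the sine of one sign up to \<open>\<tau>\<close>.\<close>
  proof (cases "a \<tau> - a 0 \<le> pi")
    case True
    show ?thesis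
    proof (rule DERIV_neg_imp_decreasing_open[OF \<tau>(1) _ u_cont])
      fix x assume x: "0 < x" "x < \<tau>"
      have "sin (a x - a 0) > 0"
        using a_mono[OF x(1)] a_mono[OF x(2)] True by (intro sin_gt_zero) auto
      then have "- m x * sin (a x - a 0) < 0" using m[of x] by simp
      then show "\<exists>y. (u has_real_derivative y) (at x) \<and> y < 0"
        using u' by blast
    qed
  next
    case False
    have "u \<tau> < u (2 * pi)"
    proof (rule DERIV_pos_imp_increasing_open[OF \<tau>(2) _ u_cont])
      fix x assume x: "\<tau> < x" "x < 2 * pi"
      have "sin (a x - a 0) < 0"
        using a_mono[OF x(1)] a_mono[OF x(2)] False a2pi by (intro sin_lt_zero) auto
      then have "- m x * sin (a x - a 0) > 0" using m[of x] by (simp add: mult_less_0_iff)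
      then show "\<exists>y. (u has_real_derivative y) (at x) \<and> y > 0"
        using u' by blast
    qed
    then show ?thesis by (simp add: u_def c0)
  qed
  then show ?thesis by (simp add: u_def c0 z algebra_simps)
qed

text \<open>On the circle itself the support line separates the points. Inside, the maximum
  principle keeps the image in the closed half-plane bounded by the tangent at \<open>h w\<close>; a
  point mapped to \<open>h w\<close> would lie on its edge, and the nonzero derivative would push
  nearby values across.\<close>

lemma inj_at_boundary:
  assumes "cmod w < 1" "cmod z \<le> cmod w" "z \<noteq> w"
  shows "h z \<noteq> h w"
proof (cases "cmod z = cmod w")
  case True
  then show ?thesis using support_line_circle[OF assms(1) True assms(3)] by auto
next
  case False
  define r where "r = cmod w"
  have r: "cmod z < r" "0 < r" "r < 1" using False assms by (auto simp: r_def intro: le_less_trans[of 0 "cmod z"])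
  define b where "b = cnj (w * deriv h w)"
  have "b \<noteq> 0" using deriv_nonzero[of w] assms r by (auto simp: b_def r_def)
  define G where "G x = b * (h x - h w)" for x
  have holG: "G holomorphic_on ball 0 1"
    unfolding G_def by (intro holomorphic_intros holomorphic)
  have ReG: "Re (G x) \<le> 0" if "x \<in> ball 0 r" for x
  proof (rule maximum_real_frontier[where f = G and B = 0 and \<xi> = x and S = "ball 0 r"])
    show "G holomorphic_on interior (ball 0 r)"
      using holG r by (auto intro: holomorphic_on_subset)
    show "continuous_on (closure (ball 0 r)) G"
      using holG r by (auto intro!: holomorphic_on_imp_continuous_on intro: holomorphic_on_subset)
    show "Re (G x) \<le> 0" if "x \<in> frontier (ball 0 r)" for x
    proof (cases "x = w")
      case True then show ?thesis by (simp add: G_def)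
    next
      case False
      have "cmod x = cmod w" using that r by (simp add: frontier_ball r_def)
      from support_line_circle[OF assms(1) this False]
      show ?thesis by (simp add: G_def b_def)
    qed
  qed (use that in auto)
  show ?thesis
  proof
    assume eq: "h z = h w"
    \<comment> \<open>The conjugate of the derivative of \<open>G\<close> is the direction of
      steepest ascent of \<open>Re G\<close> at \<open>z\<close>.\<close>
    define d where "d = cnj (b * deriv h z)"
    have z1: "z \<in> ball 0 1" using r by auto
    have "((\<lambda>x. G x) has_field_derivative b * deriv h z) (at z)"
      unfolding G_def by (auto intro!: derivative_eq_intros has_deriv[OF z1])
    then have der: "((\<lambda>t. Re (G (z + of_real t * d))) has_real_derivative Re (b * deriv h z * d)) (at 0)"
      by (intro has_real_derivative_Re_along) (auto intro!: derivative_eq_intros has_vector_derivative_ray)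
    have pos: "Re (b * deriv h z * d) > 0"
      using \<open>b \<noteq> 0\<close> deriv_nonzero[OF z1] 
      unfolding d_def complex_norm_square[symmetric] by simp
    obtain e where e: "e > 0" "\<And>t. 0 < t \<Longrightarrow> t < e \<Longrightarrow> Re (G (z + of_real 0 * d)) < Re (G (z + of_real (0 + t) * d))"
      using DERIV_pos_inc_right[OF der pos] by auto
    have "open (ball (0::complex) r)" "z \<in> ball 0 r" using r by auto
    then obtain e' where e': "e' > 0" "ball z e' \<subseteq> ball 0 r"
      using open_contains_ball by blast
    have d0: "cmod d > 0" using pos by auto
    define t where "t = min (e / 2) (e' / (2 * cmod d))"
    have t: "0 < t" "t < e" using e e' d0 by (auto simp: t_def)
    have "t * cmod d \<le> e' / 2" using d0 by (auto simp: t_def min_def field_simps)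
    then have "z + of_real t * d \<in> ball z e'" using t e' by (simp add: dist_norm norm_mult)
    then have "Re (G (z + of_real t * d)) \<le> 0" using ReG e' by blast
    moreover have "Re (G z) = 0" using eq by (simp add: G_def)
    ultimately show False using e(2)[OF t] by simp
  qed
qed

section \<open>Difference quotients relative to a convex mapping\<close>

text \<open>Let \<open>q x = (F x - F w) / (h x - h w)\<close>. At a maximum point \<open>z\<^sub>0 \<noteq> w\<close> of \<open>Re q\<close> on the circle,
  \<open>z\<^sub>0 q' z\<^sub>0\<close> is real and nonnegative;
  the support line at \<open>h z\<^sub>0\<close> then gives \<open>Re (q z\<^sub>0) \<le> Re (\<phi> z\<^sub>0)\<close>. This replaces integration
  along the preimage of the segment from \<open>h w\<close> to \<open>h z\<close>.\<close>
lemma Re_quotient_le: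
  assumes F: "F holomorphic_on ball 0 1"
    and F': "\<And>x. x \<in> ball 0 1 \<Longrightarrow> deriv F x = deriv h x * \<phi> x"
    and w: "cmod w < 1" and z: "cmod z = cmod w" "z \<noteq> w"
    and M: "\<And>x. cmod x = cmod w \<Longrightarrow> Re (\<phi> x) \<le> M"
  shows "Re ((F z - F w) / (h z - h w)) \<le> M"
proof -
  define r where "r = cmod w"
  have r: "0 < r" "r < 1" using w z by (auto simp: r_def)
  have wb: "w \<in> ball 0 1" using w by simp
  have sub: "cball 0 r \<subseteq> ball (0::complex) 1" using r by auto
  \<comment> \<open>The difference quotient with its removable singularity filled in, so that
    \<open>q\<close> is holomorphic at \<open>w\<close> too, with value \<open>\<phi> w\<close>
    there.\<close>
  define sl where "sl f x = (if x = w then deriv f w else (f x - f w) / (x - w))"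
    for f :: "complex \<Rightarrow> complex" and x
  have sl_hol: "sl f holomorphic_on ball 0 1" if "f holomorphic_on ball 0 1" for f
    unfolding sl_def using pole_lemma[OF that, of w] wb by simp
  have slh: "sl h x \<noteq> 0" if "x \<in> cball 0 r" for x
    using inj_at_boundary[of w x] deriv_nonzero[OF wb] that w by (auto simp: sl_def r_def)
  define q where "q x = sl F x / sl h x" for x
  have q_ne: "q x = (F x - F w) / (h x - h w)" if "x \<noteq> w" for x
    using that by (simp add: q_def sl_def)
  have q_w: "q w = \<phi> w"
    using F'[OF wb] deriv_nonzero[OF wb] by (simp add: q_def sl_def)
  have q_hol: "q holomorphic_on cball 0 r"
    unfolding q_def using sl_hol[OF F] sl_hol[OF holomorphic] sub slh
    by (intro holomorphic_intros) (auto intro: holomorphic_on_subset)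
  have q_cont: "continuous_on (cball 0 r) q"
    using q_hol by (rule holomorphic_on_imp_continuous_on)
  have "compact (sphere (0::complex) r)" "sphere (0::complex) r \<noteq> {}"
    "continuous_on (sphere 0 r) (\<lambda>x. Re (q x))"
    using r by (auto intro!: continuous_intros continuous_on_subset[OF q_cont])
  then obtain z0 where z0: "cmod z0 = r" and "\<And>x. x \<in> sphere 0 r \<Longrightarrow> Re (q x) \<le> Re (q z0)"
    using continuous_attains_sup[of "sphere 0 r" "\<lambda>x. Re (q x)"] by auto
  then have max_sphere: "Re (q x) \<le> Re (q z0)" if "cmod x = r" for x
    using that by simp
  \<comment> \<open>The maximum over the circle is also one over the closed disc, which the radial
    derivative at \<open>z0\<close> requires.\<close>
  have max: "Re (q x) \<le> Re (q z0)" if "x \<in> cball 0 r" for x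
  proof (rule maximum_real_frontier[where f = q and S = "cball 0 r" and \<xi> = x and B = "Re (q z0)"])
    show "q holomorphic_on interior (cball 0 r)"
      using q_hol by (auto intro: holomorphic_on_subset)
  qed (use q_cont max_sphere that r in auto)
  have "Re (q z0) \<le> M"
  proof (cases "z0 = w")
    case True
    then show ?thesis using M[of w] q_w by simp
  next
    case False
    have z0b: "z0 \<in> ball 0 1" using z0 r by simp
    define D where "D = h z0 - h w"
    have D: "D \<noteq> 0" using inj_at_boundary[of w z0] False z0 w by (simp add: D_def r_def)
    define q' where "q' = deriv h z0 * (\<phi> z0 - q z0) / D"
    have qd: "(q has_field_derivative q') (at z0)"
    proof -
      have hd: "(h has_field_derivative deriv h z0) (at z0)"
        and Fd: "(F has_field_derivative deriv h z0 * \<phi> z0) (at z0)"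
        using has_deriv[OF z0b] holomorphic_derivI[OF F _ z0b] F'[OF z0b] by auto
      have "((\<lambda>x. (F x - F w) / (h x - h w)) has_field_derivative
          (deriv h z0 * \<phi> z0 * D - (F z0 - F w) * deriv h z0) / (D * D)) (at z0)"
        unfolding D_def by (rule derivative_eq_intros refl hd Fd | use D in \<open>simp add: D_def\<close>)+
      moreover have "(deriv h z0 * \<phi> z0 * D - (F z0 - F w) * deriv h z0) / (D * D) = q'"
        using D by (simp add: q'_def q_ne[OF False] flip: D_def) (simp add: field_simps)
      ultimately have "((\<lambda>x. (F x - F w) / (h x - h w)) has_field_derivative q') (at z0)"
        by simp
      then show ?thesis
        by (rule has_field_derivative_transform_within_open[where S = "- {w}"])
          (use False q_ne in auto)
    qed
    \<comment> \<open>Rotating \<open>z0\<close> stays on the circle, so the tangential derivative,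
      which equals \<open>- Im (q' * z0)\<close>, vanishes at the maximum.\<close>
    have "((\<lambda>t. Re (q (z0 * exp (\<i> * of_real t)))) has_real_derivative
        Re (q' * (\<i> * (z0 * exp (\<i> * of_real 0))))) (at 0)"
      by (rule has_real_derivative_Re_along[OF _ has_vector_derivative_circle]) (use qd in simp)
    then have "Re (q' * (\<i> * (z0 * exp (\<i> * of_real 0)))) = 0"
      by (rule DERIV_local_max[where d = 1]) (auto intro!: max_sphere simp: norm_mult z0)
    then have im: "Im (q' * z0) = 0"
      by (simp add: algebra_simps)
    have der: "((\<lambda>t. Re (q (of_real t * z0))) has_real_derivative Re (q' * z0)) (at 1)"
      by (rule has_real_derivative_Re_along[OF _ has_vector_derivative_ray]) (use qd in simp)
    \<comment> \<open>Moving inwards along the ray cannot raise \<open>Re q\<close>, so the outward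
      radial derivative is nonnegative.\<close>
    have re: "Re (q' * z0) \<ge> 0"
    proof (rule ccontr)
      assume "\<not> ?thesis"
      then obtain d where d: "d > 0"
        "\<And>s. 0 < s \<Longrightarrow> s < d \<Longrightarrow> Re (q (of_real 1 * z0)) < Re (q (of_real (1 - s) * z0))"
        using DERIV_neg_dec_left[OF der] by auto
      define s where "s = min (d / 2) (1 / 2)"
      have s: "0 < s" "s < d" "s \<le> 1 / 2" using d(1) by (auto simp: s_def)
      have "cmod (of_real (1 - s) * z0) = (1 - s) * r" using s z0
        by (simp add: norm_mult del: of_real_diff)
      also have "\<dots> \<le> r" using s r by (simp add: algebra_simps)
      finally have "Re (q (of_real (1 - s) * z0)) \<le> Re (q z0)" by (intro max) simp
      with d(2)[OF s(1,2)] show False by simp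
    qed
    \<comment> \<open>\<open>N\<close> is the outer normal at \<open>h z0\<close>. Multiplying the
      formula for \<open>q'\<close> by \<open>cnj N\<close> expresses
      \<open>\<phi> z0 - q z0\<close> through \<open>cnj N * D\<close>, whose real part is positive
      by the support line at \<open>h z0\<close>.\<close>
    define N where "N = z0 * deriv h z0"
    have N: "N \<noteq> 0" using deriv_nonzero[OF z0b] z0 r by (auto simp: N_def)
    define a where "a = Re (q' * z0)"
    have "q' * z0 = of_real a" using im by (simp add: a_def complex_eq_iff)
    then have "N * (\<phi> z0 - q z0) = of_real a * D"
      using D by (simp add: q'_def N_def field_simps)
    then have "cnj N * (N * (\<phi> z0 - q z0)) = cnj N * (of_real a * D)" by simp
    then have "of_real ((cmod N)\<^sup>2) * (\<phi> z0 - q z0) = of_real a * (cnj N * D)"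
      unfolding complex_norm_square by (simp only: mult_ac)
    then have "Re (of_real ((cmod N)\<^sup>2) * (\<phi> z0 - q z0)) = Re (of_real a * (cnj N * D))"
      by (rule arg_cong)
    then have "(cmod N)\<^sup>2 * Re (\<phi> z0 - q z0) = a * Re (cnj N * D)"
      by (simp only: Re_of_real_mult)
    moreover have "Re (cnj N * (h w - h z0)) < 0"
      unfolding N_def using z0 r w False by (intro support_line_circle) (auto simp: r_def)
    then have "Re (cnj N * D) > 0" by (simp add: D_def algebra_simps)
    ultimately have "0 \<le> (cmod N)\<^sup>2 * Re (\<phi> z0 - q z0)" using re by (simp add: a_def)
    then have "0 \<le> Re (\<phi> z0 - q z0)" using N by (simp add: zero_le_mult_iff)
    moreover have "Re (\<phi> z0) \<le> M" using z0 by (intro M) (simp add: r_def)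
    ultimately show ?thesis by simp
  qed
  then show ?thesis using max_sphere[of z] z q_ne[OF z(2)] by (simp add: r_def)
qed

lemma norm_diff_ge:
  assumes w: "cmod w < 1" and z: "cmod z = cmod w"
    and m: "0 < m" "\<And>x. cmod x = cmod w \<Longrightarrow> m \<le> cmod (deriv h x)"
  shows "m * cmod (z - w) \<le> cmod (h z - h w)"
proof (cases "z = w")
  case False
  define Q where "Q = (z - w) / (h z - h w)"
  have hne: "h z \<noteq> h w" using inj_at_boundary w z False by simp
  then have Q0: "Q \<noteq> 0" using False by (simp add: Q_def)
  \<comment> \<open>\<open>Re_quotient_le\<close> controls only a real part; rotating by
    \<open>b\<close> makes \<open>b * Q\<close> equal to its modulus.\<close>
  define b where "b = cnj (sgn Q)"
  have b: "cmod b = 1" using Q0 by (simp add: b_def norm_sgn)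
  have bQ: "b * Q = of_real (cmod Q)"
    using Q0 by (simp add: b_def sgn_eq field_simps flip: complex_norm_square)
      (simp add: power2_eq_square complex_norm_square[symmetric])
  have "Re ((b * z - b * w) / (h z - h w)) \<le> 1 / m"
  proof (rule Re_quotient_le[where \<phi> = "\<lambda>x. b / deriv h x"])
    show "(\<lambda>x. b * x) holomorphic_on ball 0 1" by (intro holomorphic_intros)
    show "deriv ((*) b) x = deriv h x * (b / deriv h x)" if "x \<in> ball 0 1" for x
      using deriv_nonzero[OF that] by simp
    show "Re (b / deriv h x) \<le> 1 / m" if "cmod x = cmod w" for x
    proof -
      have "Re (b / deriv h x) \<le> cmod (b / deriv h x)" by (rule complex_Re_le_cmod)
      also have "\<dots> = 1 / cmod (deriv h x)" by (simp add: norm_divide b)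
      also have "\<dots> \<le> 1 / m" using m(1) m(2)[OF that] by (intro divide_left_mono mult_pos_pos) auto
      finally show ?thesis .
    qed
  qed (use w z False in auto)
  also have "(b * z - b * w) / (h z - h w) = b * Q" by (simp add: Q_def algebra_simps diff_divide_distrib)
  finally have "cmod Q \<le> 1 / m" by (simp add: bQ)
  then show ?thesis using m(1) hne by (simp add: Q_def norm_divide field_simps)
qed simp

text \<open>Applying \<open>Re_quotient_le\<close> to \<open>- F\<close> turns its upper bound into
  a lower bound on the real part, hence on the modulus. For positive \<open>m\<close> the condition
  on \<open>\<phi>\<close> is that of close-to-convexity, imposed on one circle.\<close>

lemma norm_diff_close_to_convex_ge:
  assumes F: "F holomorphic_on ball 0 1"
    and F': "\<And>x. x \<in> ball 0 1 \<Longrightarrow> deriv F x = deriv h x * \<phi> x"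
    and w: "cmod w < 1" and z: "cmod z = cmod w"
    and m: "\<And>x. cmod x = cmod w \<Longrightarrow> m \<le> Re (\<phi> x)"
  shows "m * cmod (h z - h w) \<le> cmod (F z - F w)"
proof (cases "z = w")
  case False
  have hne: "h z \<noteq> h w" using inj_at_boundary w z False by simp
  have "Re ((- F z - - F w) / (h z - h w)) \<le> - m"
  proof (rule Re_quotient_le[where F = "\<lambda>x. - F x" and \<phi> = "\<lambda>x. - \<phi> x"])
    show "deriv (\<lambda>x. - F x) x = deriv h x * - \<phi> x" if "x \<in> ball 0 1" for x
      using DERIV_imp_deriv[OF DERIV_minus[OF holomorphic_derivI[OF F _ that]]] F'[OF that] by simp
  qed (use F w z False m in \<open>auto intro: holomorphic_intros\<close>)
  also have "(- F z - - F w) / (h z - h w) = - ((F z - F w) / (h z - h w))"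
    by (simp add: divide_simps hne)
  finally have "m \<le> Re ((F z - F w) / (h z - h w))" by simp
  also have "\<dots> \<le> cmod ((F z - F w) / (h z - h w))" by (rule complex_Re_le_cmod)
  finally show ?thesis using hne by (simp add: norm_divide field_simps)
qed simp

end

section \<open>Lower bound for the derivative of a convex mapping of order
  \<open>\<alpha>\<close>\<close>

text \<open>The Moebius map \<open>s\<close> carries the half-plane to the unit disc and 1 to 0.
  Schwarz's lemma bounds it by \<open>cmod z\<close>, and inverting the map gives the
  estimate.\<close>

lemma Re_ge_of_Re_gt_half_plane:
  fixes p :: "complex \<Rightarrow> complex" and \<alpha> :: real
  assumes hol: "p holomorphic_on ball 0 1" and p0: "p 0 = 1" and "\<alpha> < 1"
    and Re: "\<And>z. z \<in> ball 0 1 \<Longrightarrow> \<alpha> < Re (p z)" and z: "z \<in> ball 0 1"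
  shows "- 2 * (1 - \<alpha>) * cmod z / (1 + cmod z) \<le> Re (p z - 1)"
proof -
  define s where "s z = (p z - 1) / (p z + 1 - 2 * of_real \<alpha>)" for z
  have ne: "p z + 1 - 2 * of_real \<alpha> \<noteq> 0" if "z \<in> ball 0 1" for z
  proof -
    have "Re (p z + 1 - 2 * of_real \<alpha>) > 0" using Re[OF that] \<open>\<alpha> < 1\<close> by simp
    then show ?thesis by force
  qed
  have "cmod (s z) \<le> cmod z"
  proof (rule Schwarz_Lemma)
    show "s holomorphic_on ball 0 1"
      unfolding s_def using ne by (intro holomorphic_intros hol) auto
    show "cmod (s z) < 1" if "cmod z < 1" for z
    proof -
      have zb: "z \<in> ball 0 1" using that by simp
      \<comment> \<open>Four times this product is the difference of the two squared moduli compared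
        next.\<close>
      have "0 < (1 - \<alpha>) * (Re (p z) - \<alpha>)" using Re[OF zb] \<open>\<alpha> < 1\<close> by simp
      then have "(cmod (p z - 1))\<^sup>2 < (cmod (p z + 1 - 2 * of_real \<alpha>))\<^sup>2"
        unfolding cmod_power2 by (simp add: power2_eq_square algebra_simps)
      then have "cmod (p z - 1) < cmod (p z + 1 - 2 * of_real \<alpha>)"
        by (rule power_less_imp_less_base) simp
      then show ?thesis using ne[OF zb] by (simp add: s_def norm_divide)
    qed
  qed (use p0 z in \<open>auto simp: s_def\<close>)
  define \<rho> where "\<rho> = cmod z"
  have \<rho>: "0 \<le> \<rho>" "\<rho> < 1" using z by (auto simp: \<rho>_def)
  have s: "cmod (s z) \<le> \<rho>" using \<open>cmod (s z) \<le> cmod z\<close> by (simp add: \<rho>_def)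
  have s1: "1 - s z \<noteq> 0" using s \<rho> by auto
  have "p z - 1 = s z * (p z + 1 - 2 * of_real \<alpha>)" using ne[OF z] by (simp add: s_def)
  then have "(p z - 1) * (1 - s z) = of_real (2 * (1 - \<alpha>)) * s z" by (simp add: algebra_simps)
  then have "p z - 1 = of_real (2 * (1 - \<alpha>)) * (s z / (1 - s z))"
    using s1 by (simp add: field_simps)
  also have "s z / (1 - s z) = 1 / (1 - s z) - 1" using s1 by (simp add: field_simps)
  finally have eq: "p z - 1 = of_real (2 * (1 - \<alpha>)) * (1 / (1 - s z) - 1)" .
  \<comment> \<open>The image of the disc of radius \<open>\<rho>\<close> under
    \<open>1 / (1 - s)\<close> is a disc whose leftmost point comes from
    \<open>s = - \<rho>\<close>.\<close>
  have "1 / (1 + \<rho>) \<le> Re (1 / (1 - s z))"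
  proof -
    define x where "x = Re (s z)"
    have x: "\<bar>x\<bar> \<le> \<rho>" using s abs_Re_le_cmod[of "s z"] by (simp add: x_def)
    have n: "(cmod (1 - s z))\<^sup>2 = 1 - 2 * x + (cmod (s z))\<^sup>2"
      unfolding cmod_power2 by (simp add: x_def power2_eq_square algebra_simps)
    have "(cmod (s z))\<^sup>2 \<le> \<rho>\<^sup>2" using s by (intro power_mono) auto
    moreover have "\<rho>\<^sup>2 - 2 * x + 1 \<le> (1 - x) * (1 + \<rho>)"
    proof -
      have "0 \<le> (\<rho> + x) * (1 - \<rho>)" using x \<rho> by (intro mult_nonneg_nonneg) auto
      then show ?thesis by (simp add: power2_eq_square algebra_simps)
    qed
    ultimately have "(cmod (1 - s z))\<^sup>2 \<le> (1 - x) * (1 + \<rho>)" using n by simp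
    moreover have "(cmod (1 - s z))\<^sup>2 > 0" using s1 by simp
    moreover have "Re (1 / (1 - s z)) = (1 - x) / (cmod (1 - s z))\<^sup>2"
      unfolding Re_divide cmod_power2 by (simp add: x_def power2_eq_square)
    ultimately show ?thesis using \<rho> by (simp add: divide_le_eq pos_le_divide_eq mult.commute)
  qed
  then have "2 * (1 - \<alpha>) * (1 / (1 + \<rho>) - 1) \<le> 2 * (1 - \<alpha>) * Re (1 / (1 - s z) - 1)"
    using \<open>\<alpha> < 1\<close> by (intro mult_left_mono) auto
  also have "\<dots> = Re (p z - 1)" unfolding eq by simp
  also have "2 * (1 - \<alpha>) * (1 / (1 + \<rho>) - 1) = - 2 * (1 - \<alpha>) * \<rho> / (1 + \<rho>)"
    using \<rho> by (simp add: field_simps)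
  finally show ?thesis by (simp add: \<rho>_def)
qed

text \<open>Along the ray from 0 to \<open>z\<close> the logarithmic derivative of |h'| is at least
  \<open>- 2 * (1 - \<alpha>) * cmod z / (1 + t * cmod z)\<close>. Integration gives the bound;
  \<open>H\<close> is log |h'| minus the integrated right side.\<close>

lemma (in convex_mapping) norm_deriv_ge:
  assumes "\<alpha> < 1" "deriv h 0 = 1"
    and order: "\<And>z. z \<in> ball 0 1 \<Longrightarrow> \<alpha> < Re (1 + z * deriv (deriv h) z / deriv h z)"
    and z: "z \<in> ball 0 1"
  shows "(1 + cmod z) powr (2 * \<alpha> - 2) \<le> cmod (deriv h z)"
proof -
  obtain k where k: "\<And>z. z \<in> ball 0 1 \<Longrightarrow> exp (k z) = deriv h z"
    "\<And>z. z \<in> ball 0 1 \<Longrightarrow> (k has_field_derivative deriv (deriv h) z / deriv h z) (at z)"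
    using log_deriv_exists by blast
  have bound: "- 2 * (1 - \<alpha>) * cmod z / (1 + cmod z) \<le> Re (z * deriv (deriv h) z / deriv h z)"
    if "z \<in> ball 0 1" for z
  proof -
    have "(\<lambda>z. 1 + z * deriv (deriv h) z / deriv h z) holomorphic_on ball 0 1"
      using deriv_nonzero by (intro holomorphic_intros holomorphic holomorphic_deriv) auto
    from Re_ge_of_Re_gt_half_plane[OF this _ assms(1) order that] show ?thesis by simp
  qed
  define H where "H t = Re (k (of_real t * z)) + 2 * (1 - \<alpha>) * ln (1 + t * cmod z)" for t
  have tz: "of_real t * z \<in> ball 0 1" if "0 \<le> t" "t \<le> 1" for t
    using that z mult_left_le_one_le[of "cmod z" t] by (simp add: norm_mult)
  have H': "(H has_real_derivative Re (deriv (deriv h) (of_real t * z) / deriv h (of_real t * z) * z)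
       + 2 * (1 - \<alpha>) * (cmod z / (1 + t * cmod z))) (at t)" if "0 \<le> t" "t \<le> 1" for t
  proof -
    have "1 + t * cmod z > 0" using that by (simp add: add_pos_nonneg)
    then have "((\<lambda>t. 2 * (1 - \<alpha>) * ln (1 + t * cmod z)) has_real_derivative
        2 * (1 - \<alpha>) * (cmod z / (1 + t * cmod z))) (at t)"
      by (auto intro!: derivative_eq_intros)
    then show ?thesis
      unfolding H_def
      by (intro DERIV_add has_real_derivative_Re_along k tz that has_vector_derivative_ray)
  qed
  \<comment> \<open>The half-plane estimate carries a factor \<open>t\<close>, so monotonicity is
    checked on the open interval, where \<open>t\<close> cancels.\<close>
  have "H 0 \<le> H 1"
  proof (rule DERIV_nonneg_imp_increasing_open[of 0 1 H])
    show "continuous_on {0..1} H"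
      using H' by (intro DERIV_atLeastAtMost_imp_continuous_on) blast
    fix t :: real assume t: "0 < t" "t < 1"
    let ?Q = "deriv (deriv h) (of_real t * z) / deriv h (of_real t * z) * z"
    have "- 2 * (1 - \<alpha>) * cmod (of_real t * z) / (1 + cmod (of_real t * z))
        \<le> Re (of_real t * ?Q)"
      using bound[OF tz[of t]] t by (simp add: mult_ac)
    also have "\<dots> = t * Re ?Q" by (rule Re_of_real_mult)
    also have "cmod (of_real t * z) = t * cmod z" using t by (simp add: norm_mult)
    finally have "t * (- 2 * (1 - \<alpha>) * (cmod z / (1 + t * cmod z))) \<le> t * Re ?Q"
      by (simp add: mult_ac)
    then have "- 2 * (1 - \<alpha>) * (cmod z / (1 + t * cmod z)) \<le> Re ?Q"
      using t by (simp only: mult_le_cancel_left_pos)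
    then have "0 \<le> Re ?Q + 2 * (1 - \<alpha>) * (cmod z / (1 + t * cmod z))"
      by linarith
    then show "\<exists>y. (H has_real_derivative y) (at t) \<and> 0 \<le> y"
      using H'[of t] t by (intro exI conjI) auto
  qed simp
  \<comment> \<open>\<open>k 0\<close> is determined only up to multiples of
    \<open>2 * pi * \<i>\<close>, but its real part is ln 1.\<close>
  moreover have "H 0 = 0"
  proof -
    have "exp (Re (k 0)) = cmod (exp (k 0))" by simp
    then show ?thesis using k(1)[of 0] assms(2) by (simp add: H_def)
  qed
  ultimately have "(2 * \<alpha> - 2) * ln (1 + cmod z) \<le> Re (k z)" by (simp add: H_def algebra_simps)
  moreover have "1 + cmod z > 0" by (simp add: add_pos_nonneg)
  ultimately have "(1 + cmod z) powr (2 * \<alpha> - 2) \<le> exp (Re (k z))" by (simp add: powr_def)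
  also have "\<dots> = cmod (deriv h z)" using k(1)[OF z] by (metis norm_exp_eq_Re)
  finally show ?thesis .
qed

section \<open>The two estimates combined for the class F\<close>

text \<open>The unimodular factor is arbitrary because the harmonic case uses one that depends on
  the two points.\<close>

lemma classF_norm_diff_ge:
  assumes \<alpha>: "0 \<le> \<alpha>" "\<alpha> < 1" and F: "classF \<alpha> h g" and lam: "cmod lam = 1"
    and w: "cmod w < 1" "w \<noteq> 0" and z: "cmod z = cmod w"
  shows "Afun (cmod w) \<alpha> * cmod (z - w) \<le> cmod ((h z + lam * g z) - (h w + lam * g w))"
proof -
  define r where "r = cmod w"
  have r: "0 < r" "r < 1" using w by (auto simp: r_def)
  from F obtain \<theta> :: real where hol: "h holomorphic_on ball 0 1" "g holomorphic_on ball 0 1"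
    and h0: "deriv h 0 = 1" and nz: "\<And>z. z \<in> ball 0 1 \<Longrightarrow> deriv h z \<noteq> 0"
    and order: "\<And>z. z \<in> ball 0 1 \<Longrightarrow> \<alpha> < Re (1 + z * deriv (deriv h) z / deriv h z)"
    and g': "\<And>z. z \<in> ball 0 1 \<Longrightarrow> deriv g z = exp (\<i> * of_real \<theta>) * z * deriv h z"
    unfolding classF_def by blast
  interpret convex_mapping h
    by unfold_locales (use hol nz order \<alpha> in \<open>auto intro: le_less_trans\<close>)
  let ?m = "(1 + r) powr (2 * \<alpha> - 2)"
  have "?m * cmod (z - w) \<le> cmod (h z - h w)"
  proof (rule norm_diff_ge[OF w(1) z])
    show "?m \<le> cmod (deriv h x)" if "cmod x = cmod w" for x
      using norm_deriv_ge[OF \<alpha>(2) h0 order, of x] that r by (simp add: r_def)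
  qed (use r in simp)
  then have "(1 - r) * (?m * cmod (z - w)) \<le> (1 - r) * cmod (h z - h w)"
    using r by (intro mult_left_mono) auto
  also have "(1 - r) * cmod (h z - h w) \<le> cmod ((h z + lam * g z) - (h w + lam * g w))"
  proof (rule norm_diff_close_to_convex_ge[where F = "\<lambda>x. h x + lam * g x"
        and \<phi> = "\<lambda>x. 1 + lam * exp (\<i> * of_real \<theta>) * x", OF _ _ w(1) z])
    show "(\<lambda>x. h x + lam * g x) holomorphic_on ball 0 1"
      by (intro holomorphic_intros hol)
    show "deriv (\<lambda>x. h x + lam * g x) x = deriv h x * (1 + lam * exp (\<i> * of_real \<theta>) * x)"
      if x: "x \<in> ball 0 1" for x
    proof (rule DERIV_imp_deriv)
      have "((\<lambda>x. h x + lam * g x) has_field_derivative deriv h x + lam * deriv g x) (at x)"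
        using hol x by (intro DERIV_add DERIV_cmult holomorphic_derivI) auto
      then show "((\<lambda>x. h x + lam * g x) has_field_derivative deriv h x * (1 + lam * exp (\<i> * of_real \<theta>) * x)) (at x)"
        by (simp add: g'[OF x] algebra_simps)
    qed
    show "1 - r \<le> Re (1 + lam * exp (\<i> * of_real \<theta>) * x)" if "cmod x = cmod w" for x
    proof -
      have "cmod (lam * exp (\<i> * of_real \<theta>) * x) = r"
        using that lam by (simp add: norm_mult r_def)
      then show ?thesis
        using abs_Re_le_cmod[of "lam * exp (\<i> * of_real \<theta>) * x"] by simp
    qed
  qed
  finally have "(1 - r) * ?m * cmod (z - w) \<le> cmod ((h z + lam * g z) - (h w + lam * g w))"
    by (simp add: mult_ac)
  moreover have "Afun r \<alpha> * cmod (z - w) \<le> (1 - r) * ?m * cmod (z - w)"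
    using Afun_le[OF \<alpha> r] by (intro mult_right_mono) auto
  ultimately show ?thesis by (simp add: r_def)
qed

theorem theorem1:
  fixes \<alpha> r t \<psi> :: real and lam :: complex and h g :: "complex \<Rightarrow> complex"
  assumes "0 \<le> \<alpha>" "\<alpha> < 1"
    and "classF \<alpha> h g"
    and "0 < r" "r < 1"
    and "cmod lam = 1"
    and "r * exp (\<i> * t) \<noteq> r * exp (\<i> * \<psi>)"
  shows "cmod (((h (r * exp (\<i> * t)) + lam * g (r * exp (\<i> * t)))
               - (h (r * exp (\<i> * \<psi>)) + lam * g (r * exp (\<i> * \<psi>))))
              / (r * exp (\<i> * t) - r * exp (\<i> * \<psi>))) \<ge> Afun r \<alpha> \<and>
         cmod (((h (r * exp (\<i> * t)) + cnj (g (r * exp (\<i> * t))))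
               - (h (r * exp (\<i> * \<psi>)) + cnj (g (r * exp (\<i> * \<psi>)))))
              / (r * exp (\<i> * t) - r * exp (\<i> * \<psi>))) \<ge> Afun r \<alpha>"
proof -
  define z where "z = r * exp (\<i> * t)"
  define w where "w = r * exp (\<i> * \<psi>)"
  have n: "cmod z = r" "cmod w = r" "w \<noteq> 0" using assms by (simp_all add: z_def w_def norm_mult)
  have zw: "cmod (z - w) > 0" using assms(7) by (simp add: z_def w_def)
  have key: "Afun r \<alpha> * cmod (z - w) \<le> cmod ((h z + \<mu> * g z) - (h w + \<mu> * g w))" if "cmod \<mu> = 1" for \<mu>
    using classF_norm_diff_ge[OF assms(1-3) that, of w z] n assms by auto
  \<comment> \<open>a unimodular \<open>\<mu>\<close> turns \<open>g z - g w\<close> into its conjugate, so the bound for \<open>h + \<mu> g\<close> is the one for \<open>f\<close>\<close>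
  define d where "d = g z - g w"
  obtain \<mu> where \<mu>: "cmod \<mu> = 1" "\<mu> * d = cnj d"
  proof (cases "d = 0")
    case True
    then show ?thesis using that[of 1] by simp
  next
    case False
    then show ?thesis using that[of "cnj d / d"] by (simp add: norm_divide)
  qed
  have "(h z + cnj (g z)) - (h w + cnj (g w)) = h z - h w + cnj d" by (simp add: d_def)
  also have "\<dots> = (h z + \<mu> * g z) - (h w + \<mu> * g w)"
    unfolding \<mu>(2)[symmetric] by (simp add: d_def algebra_simps)
  finally have "Afun r \<alpha> * cmod (z - w) \<le> cmod ((h z + cnj (g z)) - (h w + cnj (g w)))"
    using key[OF \<mu>(1)] by (simp only:)
  with key[OF assms(6)] have
    "Afun r \<alpha> \<le> cmod (((h z + lam * g z) - (h w + lam * g w)) / (z - w))"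
    "Afun r \<alpha> \<le> cmod (((h z + cnj (g z)) - (h w + cnj (g w))) / (z - w))"
    using zw by (simp_all add: norm_divide pos_le_divide_eq)
  then show ?thesis unfolding z_def w_def by blast
qed

end
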